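(* Let $m$ be a positive odd integer with odd root $2^y \cdot 3^u \cdot b - 1$, where $y \ge 1$ and $u \ge 0$ are integers and $b \geq 1$ is an odd integer not divisible by $3$. Then after $y$ reduced Collatz iterations, the resulting odd number $R^{y}(m)$ has root $3^{u+y} \cdot b - 1$, which is even.
   Context: For a positive odd integer $m$, the root of $m$ is the integer $a \ge 0$ with $m = 2a+1$. The reduced Collatz iteration sends a positive odd integer $m$ to $R(m) = \frac{3m+1}{2^x}$, where $2^x$ is the highest power of $2$ dividing $3m+1$; $R^{y}$ denotes the $y$-fold iterate of $R$. *)

theory Defs
  imports "HOL-Computational_Algebra.Primes"
begin

text \<open>Only meaningful for odd arguments; \<open>THE\<close> returns an unspecified value on even ones.\<close>

definition collatz_root :: "nat \<Rightarrow> nat" where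
  "collatz_root m = (THE a. m = 2 * a + 1)"

definition reduced_collatz :: "nat \<Rightarrow> nat" where
  "reduced_collatz m = (3 * m + 1) div 2 ^ multiplicity 2 (3 * m + 1)"

end

theory Submission
  imports Defs
begin

text \<open>
  In terms of \<open>m + 1 = 2 * (root + 1)\<close>, one reduced iteration replaces a factor \<open>2\<close> by a
  factor \<open>3\<close> as long as \<open>4\<close> divides \<open>m + 1\<close>. Starting from \<open>m + 1 = 2 ^ (y + 1) * c\<close>, this
  happens \<open>y\<close> times and ends at \<open>2 * 3 ^ y * c\<close>.
\<close>

lemma collatz_root_double_plus_one [simp]: "collatz_root (2 * a + 1) = a"
  unfolding collatz_root_def by (rule the_equality) auto

lemma double_collatz_root_plus_one:
  assumes "odd m"
  shows "2 * collatz_root m + 1 = m"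
  using assms by (elim oddE) (simp only: collatz_root_double_plus_one)

text \<open>Tripling and adding one gives \<open>2 * (6 * n - 1)\<close>, whose second factor is
  odd, so exactly one halving takes place.\<close>

lemma reduced_collatz_four_times_minus_one:
  assumes "n > 0"
  shows "reduced_collatz (4 * n - 1) = 6 * n - 1"
proof -
  have eq: "3 * (4 * n - 1) + 1 = 2 * (6 * n - 1)"
    using assms by simp
  have "\<not> 2 dvd 6 * n - 1"
    using assms by presburger
  hence "multiplicity 2 (2 * (6 * n - 1)) = 1"
    by (intro multiplicity_eqI) simp_all
  thus ?thesis
    unfolding reduced_collatz_def eq by simp
qed

lemma reduced_collatz_iterate:
  assumes "c > 0"
  shows "(reduced_collatz ^^ y) (2 ^ Suc y * c - 1) = 2 * 3 ^ y * c - 1"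
  using assms
\<comment> \<open>\<open>c\<close> must vary: the first iteration trades one 2 for a 3, which is
  absorbed into \<open>c\<close>.\<close>
proof (induction y arbitrary: c)
  case (Suc y)
  have "reduced_collatz (2 ^ Suc (Suc y) * c - 1) = 2 ^ Suc y * (3 * c) - 1"
    using reduced_collatz_four_times_minus_one[of "2 ^ y * c"] Suc.prems
    by (simp add: mult_ac)
  thus ?case
    using Suc.IH[of "3 * c"] Suc.prems
    \<comment> \<open>The first iteration is peeled off innermost; powers stay folded so that the
      facts match.\<close>
    by (simp add: funpow_Suc_right mult_ac del: funpow.simps power_Suc)
       (simp add: mult_ac)
qed simp

theorem theorem4:
  fixes m y u b :: nat
  assumes "m > 0" and "odd m"
    and "odd (collatz_root m)"
    and "collatz_root m = 2 ^ y * 3 ^ u * b - 1"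
    and "y \<ge> 1" and "u \<ge> 0"
    and "b \<ge> 1" and "odd b" and "\<not> 3 dvd b"
  shows "odd ((reduced_collatz ^^ y) m)
    \<and> collatz_root ((reduced_collatz ^^ y) m) = 3 ^ (u + y) * b - 1
    \<and> even (collatz_root ((reduced_collatz ^^ y) m))"
proof -
  define k where "k = 3 ^ (u + y) * b"
  have "odd k"
    using assms by (simp add: k_def)
  hence "k > 0"
    by (rule odd_pos)
  \<comment> \<open>Rules out truncation in the subtraction that gives the root.\<close>
  have "2 ^ y * 3 ^ u * b > 0"
    using assms by simp
  hence "m = 2 * (2 ^ y * 3 ^ u * b) - 1"
    using double_collatz_root_plus_one[OF \<open>odd m\<close>] assms(4) by linarith
  hence "m = 2 ^ Suc y * (3 ^ u * b) - 1"
    by (simp add: mult_ac)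
  hence "(reduced_collatz ^^ y) m = 2 * k - 1"
    using reduced_collatz_iterate[of "3 ^ u * b" y] assms
    by (simp add: k_def power_add mult_ac)
  \<comment> \<open>This form exhibits the root \<open>k - 1\<close>, even because \<open>k\<close>
    is odd.\<close>
  also have "\<dots> = 2 * (k - 1) + 1"
    using \<open>k > 0\<close> by simp
  finally have "(reduced_collatz ^^ y) m = 2 * (k - 1) + 1" .
  thus ?thesis
    using \<open>odd k\<close> by (simp only: collatz_root_double_plus_one k_def) simp
qed

end
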